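(* Let $G$ be a simple graph with $n$ vertices and vertex set $V$, and let $\chi_f(G)$ denote its fractional chromatic number. Then $$\min\{k : \forall\, w \in \mathbb{R}_+^V,\ \vartheta_k(G;w) \geq w^{T}\mathbf{1}\} \leq \lceil \chi_f(G)\rceil,$$ where $k$ ranges over the integers between $1$ and $n$. In particular, $$h(G) \leq \lceil \chi_f(G)\rceil .$$
   Context: Graphs $G=(V,E)$ are finite and simple with $n=|V|\ge 1$ vertices. $\mathbb{S}^V$ is the set of real symmetric matrices with rows and columns indexed by $V$; $\mathbb{R}_+^V$ is the set of entrywise non-negative vectors indexed by $V$ (also written $w\ge \mathbf{0}$); $\mathbf{1}$ is the all-ones vector; $\sqrt{w}$ is the entrywise square root of $w$; $\langle A,B\rangle=\operatorname{tr}(AB)$ on $\mathbb{S}^V$; $A\preccurlyeq B$ means that $B-A$ is positive semidefinite; $\lambda_1(M)\ge\dots\ge\lambda_n(M)$ are the eigenvalues of $M\in\mathbb{S}^V$ with multiplicity. The condition "$Z_{ij}=0$ for all $ij\notin E$" includes the diagonal positions, so $Z$ has zero diagonal. For $w\in\mathbb{R}_+^V$ and an integer $k$ with $0\le k\le n$, $$\vartheta_k(G;w)=\min\Big\{\sum_{i=1}^k\lambda_i\big(\sqrt{w}\sqrt{w}^{T}+Z\big): Z\in\mathbb{S}^V,\ Z_{ij}=0\ \forall ij\notin E\Big\}.$$ Equivalently (by semidefinite programming duality) $$\vartheta_k(G;w)=\max\big\{\langle\sqrt{w}\sqrt{w}^{T},X\rangle: X\in\mathbb{S}^V,\ \operatorname{tr}X=k,\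 X_{ij}=0\ \forall ij\in E,\ 0\preccurlyeq X\preccurlyeq I\big\},$$ and this second formula defines $\vartheta_k(G;w)$ for every real $k$ with $0\le k\le n$. $h(G)$ is the smallest integer $m\ge1$ such that for all $Z\in\mathbb{S}^V$ with $Z_{ij}=0$ for all $ij\notin E$, $$\lambda_1(Z)+\lambda_n(Z)+\lambda_{n-1}(Z)+\dots+\lambda_{n-m+2}(Z)\le 0,$$ i.e. $\lambda_1(Z)+\sum_{i=1}^{m-1}\lambda_{n+1-i}(Z)\le0$ (for $m=1$ the condition is $\lambda_1(Z)\le0$). The fractional chromatic number is $\chi_f(G)=\min\{\sum_S y_S : y_S\ge 0,\ \sum_{S\ni v}y_S=1\ \forall v\in V\}$, where $S$ ranges over the cocliques (independent sets) of $G$. *)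

theory Defs
  imports "HOL-Analysis.Analysis" "HOL-Computational_Algebra.Computational_Algebra"
begin

text \<open>
  The vertex set is a finite type \<open>'v\<close>, so \<open>n = CARD('v) \<ge> 1\<close>. A simple graph on it is a
  symmetric, irreflexive relation \<open>E\<close>: \<open>ij \<in> E\<close> means \<open>(i, j) \<in> E\<close>, and no \<open>(i, i)\<close> is in \<open>E\<close>.
\<close>

definition simple_graph :: "('v \<times> 'v) set \<Rightarrow> bool" where
  "simple_graph E \<longleftrightarrow> sym E \<and> irrefl E"

text \<open>The determinant of \<open>xI - M\<close>, computed over the polynomial ring.\<close>

definition charpoly :: "real ^ 'v ^ 'v \<Rightarrow> real poly" where
  "charpoly M = det (\<chi> i j. (if i = j then [:0, 1:] else 0) - [:M $ i $ j:])"

text \<open>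
  \<open>eigval M i\<close> is \<open>\<lambda>\<^sub>i(M)\<close>, with \<open>i\<close> counted from 1 in decreasing order with multiplicity. It is
  meant for symmetric \<open>M\<close>, whose characteristic polynomial has exactly \<open>n\<close> real roots, and for
  \<open>1 \<le> i \<le> n\<close>.
\<close>

definition eigval :: "real ^ 'v ^ 'v \<Rightarrow> nat \<Rightarrow> real" where
  "eigval M i = rev (sorted_list_of_multiset (proots (charpoly M))) ! (i - 1)"

text \<open>As \<open>E\<close> is irreflexive, the condition on \<open>ij \<notin> E\<close> includes the diagonal.\<close>

definition weighted_adjacency :: "('v \<times> 'v) set \<Rightarrow> (real ^ 'v ^ 'v) set" where
  "weighted_adjacency E = {Z. transpose Z = Z \<and> (\<forall>i j. (i, j) \<notin> E \<longrightarrow> Z $ i $ j = 0)}"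

definition sqrt_outer :: "real ^ 'v \<Rightarrow> real ^ 'v ^ 'v" where
  "sqrt_outer w = (\<chi> i j. sqrt (w $ i) * sqrt (w $ j))"

text \<open>
  For \<open>0 \<le> k \<le> n\<close> the set below is nonempty (take \<open>Z = 0\<close>), and it is bounded below by
  \<open>k / n\<close> times the sum of the entries of \<open>w\<close>, because the matrices all have that sum as trace. The
  infimum is attained: for \<open>k = 0\<close> and \<open>k = n\<close> the objective is constant, and for \<open>0 < k < n\<close> its
  sublevel sets are compact, since the trace is fixed.
\<close>

definition vartheta :: "nat \<Rightarrow> ('v \<times> 'v) set \<Rightarrow> real ^ 'v \<Rightarrow> real" where
  "vartheta k E w =
     Inf {\<Sum>i = 1..k. eigval (sqrt_outer w + Z) i | Z. Z \<in> weighted_adjacency E}"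

text \<open>
  \<open>m = n\<close> always satisfies the condition, the left-hand side then being the trace of \<open>Z\<close>, so the
  least \<open>m\<close> exists and only indices between 1 and \<open>n\<close> matter.
\<close>

definition h_graph :: "('v::finite \<times> 'v) set \<Rightarrow> nat" where
  "h_graph E = (LEAST m. 1 \<le> m \<and>
     (\<forall>Z \<in> weighted_adjacency E.
        eigval Z 1 + (\<Sum>i = 1..m - 1. eigval Z (CARD('v) + 1 - i)) \<le> 0))"

definition coclique :: "('v \<times> 'v) set \<Rightarrow> 'v set \<Rightarrow> bool" where
  "coclique E S \<longleftrightarrow> (\<forall>i \<in> S. \<forall>j \<in> S. (i, j) \<notin> E)"

text \<open>
  The feasible set is nonempty (put weight 1 on each singleton), and the infimum of this linear
  program is attained, its objective being nonnegative.
\<close>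

definition fractional_chromatic_number :: "('v::finite \<times> 'v) set \<Rightarrow> real" where
  "fractional_chromatic_number E =
     Inf {\<Sum>S | coclique E S. y S | y :: 'v set \<Rightarrow> real.
       (\<forall>S. coclique E S \<longrightarrow> 0 \<le> y S) \<and> (\<forall>v. (\<Sum>S | coclique E S \<and> v \<in> S. y S) = 1)}"

end

theory Submission
  imports Defs
begin

text \<open>
  Let \<open>y\<close> be an optimal fractional colouring, \<open>x\<close> a vector and \<open>u\<^sub>S\<close> the normalised restriction of \<open>x\<close> to
  a coclique \<open>S\<close>. The matrix \<open>Y = \<Sum>\<^sub>S y\<^sub>S u\<^sub>S u\<^sub>S\<^sup>T\<close> vanishes on the edges, satisfies \<open>0 \<le> Y \<le> I\<close> and
  \<open>x\<^sup>T Y x = x\<^sup>T x\<close>, and its trace is at most \<open>\<chi>\<^sub>f\<close>; adding a multiple of \<open>I - Y\<close> raises the trace to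
  \<open>k = \<lceil>\<chi>\<^sub>f\<rceil>\<close> without losing these properties. For \<open>x = \<surd>w\<close> the resulting matrix \<open>X\<close> is feasible in
  the dual program, with value \<open>w\<^sup>T 1\<close>, and Ky Fan's inequality gives the bound on \<open>\<vartheta>\<^sub>k\<close>. For \<open>x\<close> a unit
  eigenvector of the largest eigenvalue of \<open>Z\<close>, expanding \<open>0 = tr (Z X)\<close> in an eigenbasis of \<open>Z\<close> gives
  \<open>\<lambda>\<^sub>1\<close> the coefficient 1 and the other eigenvalues coefficients in \<open>[0, 1]\<close> with sum \<open>k - 1\<close>, which
  bounds \<open>h\<close>.
\<close>

subsection \<open>Spectral decomposition of symmetric matrices\<close>

text \<open>A maximiser of the Rayleigh quotient on the unit sphere of \<open>S\<close> exists by
  compactness and is an eigenvector; invariance of \<open>S\<close> keeps the residual inside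
  \<open>S\<close>.\<close>

lemma selfadjoint_max_eigenvector:
  fixes f :: "'a::euclidean_space \<Rightarrow> 'a"
  assumes f: "linear f" and sa: "\<And>x y. f x \<bullet> y = x \<bullet> f y"
    and S: "subspace S" "f ` S \<subseteq> S" "S \<noteq> {0}"
  obtains v where "v \<in> S" "norm v = 1" "f v = (v \<bullet> f v) *\<^sub>R v"
proof -
  let ?K = "S \<inter> sphere 0 1"
  have "compact ?K"
    using S(1) by (simp add: closed_subspace closed_Int_compact)
  moreover have "?K \<noteq> {}"
  proof -
    obtain x where x: "x \<in> S" "x \<noteq> 0" using S(1,3) subspace_0 by blast
    then have "(1 / norm x) *\<^sub>R x \<in> ?K" using S(1) by (simp add: subspace_scale)
    then show ?thesis by blast
  qed
  moreover have "continuous_on ?K (\<lambda>x. x \<bullet> f x)"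
    using f by (intro continuous_intros linear_continuous_on linear_conv_bounded_linear[THEN iffD1])
  ultimately obtain v where v: "v \<in> ?K" and max: "\<And>x. x \<in> ?K \<Longrightarrow> x \<bullet> f x \<le> v \<bullet> f v"
    by (metis continuous_attains_sup)
  define c where "c = v \<bullet> f v"
  have vS: "v \<in> S" and vv: "v \<bullet> v = 1" using v by (auto simp: norm_eq_1)
  have le: "x \<bullet> f x \<le> c * (x \<bullet> x)" if "x \<in> S" for x
  proof (cases "x = 0")
    case True
    then show ?thesis by simp
  next
    case False
    have "(1 / norm x) *\<^sub>R x \<in> ?K" using S(1) that False by (simp add: subspace_scale)
    from max[OF this] have "x \<bullet> f x / (norm x * norm x) \<le> c"
      by (simp add: c_def linear_cmul[OF f])
    then show ?thesis using False by (simp add: divide_le_eq dot_square_norm power2_eq_square mult_pos_pos)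
  qed
  \<comment> \<open>First-order optimality: the residual \<open>w\<close> is orthogonal to \<open>v\<close>, so moving from \<open>v\<close> towards \<open>w\<close>
    would increase the Rayleigh quotient unless \<open>w = 0\<close>.\<close>
  define w where "w = f v - c *\<^sub>R v"
  have wS: "w \<in> S" unfolding w_def using S(1,2) vS by (intro subspace_diff subspace_scale) auto
  have vw: "v \<bullet> w = 0" by (simp add: w_def inner_diff_right c_def vv)
  have wfv: "w \<bullet> f v = w \<bullet> w"
  proof -
    have "f v = w + c *\<^sub>R v" by (simp add: w_def)
    then show ?thesis using vw by (simp add: inner_add_right inner_commute)
  qed
  \<comment> \<open>Along \<open>v + t *\<^sub>R w\<close>, the first-order gain is
    \<open>2 * t * (w \<bullet> w)\<close>, and \<open>K\<close> is the coefficient of the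
    second-order loss.\<close>
  define K where "K = c * (w \<bullet> w) - w \<bullet> f w"
  have ineq: "2 * (w \<bullet> w) \<le> t * K" if "t > 0" for t
  proof -
    have "v + t *\<^sub>R w \<in> S" using S(1) vS wS by (simp add: subspace_add subspace_scale)
    from le[OF this] have "c + 2 * t * (w \<bullet> w) + t * t * (w \<bullet> f w) \<le> c * (1 + t * t * (w \<bullet> w))"
      using wfv sa[of v w] vw vv
      by (simp add: linear_add[OF f] linear_cmul[OF f] inner_add_left inner_add_right
          inner_commute c_def algebra_simps)
    then have "t * (2 * (w \<bullet> w)) \<le> t * (t * K)" by (simp add: K_def algebra_simps)
    then show ?thesis using that by simp
  qed
  have "w \<bullet> w = 0"
  proof (rule ccontr)
    assume "w \<bullet> w \<noteq> 0"
    then have pos: "w \<bullet> w > 0" by simp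
    \<comment> \<open>Positivity of \<open>K\<close> makes \<open>(w \<bullet> w) / K\<close> an
      admissible \<open>t\<close>, for which \<open>ineq\<close> would read
      \<open>2 * (w \<bullet> w) \<le> w \<bullet> w\<close>.\<close>
    have "K > 0" using ineq[of 1] pos by linarith
    then show False using ineq[of "(w \<bullet> w) / K"] pos by simp
  qed
  then have "f v = (v \<bullet> f v) *\<^sub>R v" by (simp add: w_def c_def)
  then show ?thesis using that[of v] v by simp
qed

text \<open>Induction on the dimension: split off one unit eigenvector \<open>v\<close>;
  self-adjointness makes the orthogonal complement of \<open>v\<close> in \<open>S\<close> invariant
  again.\<close>

lemma selfadjoint_eigenbasis:
  fixes f :: "'a::euclidean_space \<Rightarrow> 'a"
  assumes f: "linear f" and sa: "\<And>x y. f x \<bullet> y = x \<bullet> f y"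
    and "subspace S" "f ` S \<subseteq> S"
  shows "\<exists>B. B \<subseteq> S \<and> finite B \<and> card B = dim S \<and> pairwise orthogonal B \<and>
    (\<forall>b\<in>B. norm b = 1 \<and> f b = (b \<bullet> f b) *\<^sub>R b)"
  using assms(3,4)
proof (induction "dim S" arbitrary: S)
  case 0
  then show ?case by (intro exI[of _ "{}"]) auto
next
  case (Suc n)
  then have "S \<noteq> {0}" by auto
  then obtain v where v: "v \<in> S" "norm v = 1" "f v = (v \<bullet> f v) *\<^sub>R v"
    using selfadjoint_max_eigenvector[OF f sa Suc.prems] by blast
  define T where "T = {y \<in> S. \<forall>x \<in> span {v}. orthogonal x y}"
  have "dim T + dim (span {v}) = dim S"
    unfolding T_def
    using v Suc.prems by (intro dim_subspace_orthogonal_to_vectors) (auto simp: span_minimal)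
  moreover have "dim (span {v}) = 1"
    using v by (auto simp: dim_span dim_insert)
  ultimately have dimT: "n = dim T" using Suc(2) by simp
  have T: "T = {y \<in> S. v \<bullet> y = 0}"
    unfolding T_def by (auto simp: orthogonal_def span_singleton)
  have subT: "subspace T"
    unfolding T using Suc.prems(1) by (auto simp: subspace_def inner_add_right)
  have "f ` T \<subseteq> T"
  proof
    fix y assume "y \<in> f ` T"
    then obtain x where x: "x \<in> S" "v \<bullet> x = 0" "y = f x" unfolding T by auto
    have "v \<bullet> f x = f v \<bullet> x" by (simp add: sa)
    also have "\<dots> = 0" by (subst v(3)) (simp add: x)
    finally show "y \<in> T" unfolding T using x Suc.prems(2) by auto
  qed
  from Suc(1)[OF dimT subT this] obtain B where B: "B \<subseteq> T" "finite B" "card B = n"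
    "pairwise orthogonal B" "\<forall>b\<in>B. norm b = 1 \<and> f b = (b \<bullet> f b) *\<^sub>R b"
    using dimT by auto
  have "v \<notin> B" using B(1) v(2) unfolding T by auto
  show ?case
  proof (intro exI[of _ "insert v B"] conjI)
    show "pairwise orthogonal (insert v B)"
      using B(1,4) unfolding T by (auto simp: pairwise_insert orthogonal_def inner_commute)
  qed (use B v \<open>v \<notin> B\<close> Suc(2) in \<open>auto simp: T\<close>)
qed

text \<open>The rows of \<open>P\<close> are an orthonormal eigenbasis, and \<open>M\<close> is
  expanded as \<open>M ** (transpose P ** P)\<close>.\<close>

lemma symmetric_matrix_diagonalisation:
  fixes M :: "real ^ 'n ^ 'n"
  assumes "transpose M = M"
  obtains P :: "real ^ 'n ^ 'n" and d :: "'n \<Rightarrow> real"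
  where "orthogonal_matrix P" "\<And>a b. M $ a $ b = (\<Sum>v\<in>UNIV. d v * P $ v $ a * P $ v $ b)"
proof -
  have sa: "(M *v x) \<bullet> y = x \<bullet> (M *v y)" for x y
    by (metis assms dot_lmul_matrix inner_commute transpose_matrix_vector)
  obtain B where B: "card B = CARD('n)" "finite B" "pairwise orthogonal B"
    and ev: "\<And>b. b \<in> B \<Longrightarrow> norm b = 1 \<and> M *v b = (b \<bullet> (M *v b)) *\<^sub>R b"
    using selfadjoint_eigenbasis[OF matrix_vector_mul_linear[of M] sa subspace_UNIV] by auto
  obtain p where p: "bij_betw p (UNIV :: 'n set) B"
    using B finite_same_card_bij[of "UNIV :: 'n set" B] by auto
  define P where "P = (\<chi> i. p i)"
  define d where "d i = p i \<bullet> (M *v p i)" for i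
  have pB: "p i \<in> B" for i using p by (auto simp: bij_betw_def)
  have "orthogonal_matrix P"
    unfolding orthogonal_matrix_orthonormal_rows
  proof (intro conjI allI impI)
    fix i j :: 'n
    show "norm (row i P) = 1" using ev[OF pB[of i]] by (simp add: P_def row_def)
    assume "i \<noteq> j"
    then have "p i \<noteq> p j" using p by (metis UNIV_I bij_betw_imp_inj_on inj_onD)
    then show "orthogonal (row i P) (row j P)"
      using B(3) pB by (simp add: P_def row_def pairwise_def)
  qed
  then have PP: "transpose P ** P = mat 1" by (simp add: orthogonal_matrix)
  have Mp: "(M *v p v) $ a = d v * p v $ a" for v a
    using ev[OF pB[of v]] unfolding d_def by (metis vector_scaleR_component real_scaleR_def)
  have "M $ a $ b = (\<Sum>v\<in>UNIV. d v * P $ v $ a * P $ v $ b)" for a b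
  proof -
    have "M $ a $ b = (M ** (transpose P ** P)) $ a $ b" by (simp add: PP)
    also have "\<dots> = ((M ** transpose P) ** P) $ a $ b" by (simp add: matrix_mul_assoc)
    also have "\<dots> = (\<Sum>v\<in>UNIV. (M ** transpose P) $ a $ v * P $ v $ b)"
      by (simp add: matrix_matrix_mult_def)
    also have "\<dots> = (\<Sum>v\<in>UNIV. (M *v p v) $ a * P $ v $ b)"
      by (simp add: matrix_matrix_mult_def matrix_vector_mult_def transpose_def P_def)
    finally show ?thesis by (simp add: Mp) (simp add: P_def)
  qed
  with \<open>orthogonal_matrix P\<close> show ?thesis using that by blast
qed

section \<open>Eigenvalues as roots of the characteristic polynomial\<close>

lemma sum_linear_poly: "(\<Sum>v\<in>A. [:f v, g v:]) = [:\<Sum>v\<in>A. f v, \<Sum>v\<in>A. g v:]"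
  by (induction A rule: infinite_finite_induct) auto

text \<open>Lifting \<open>P\<close> to a matrix \<open>C\<close> of constant polynomials factors
  the characteristic matrix as \<open>transpose C ** D ** C\<close> with \<open>D\<close> diagonal;
  the determinants of the outer factors cancel.\<close>

lemma charpoly_diagonalisation:
  fixes P :: "real ^ 'n ^ 'n"
  assumes P: "orthogonal_matrix P"
    and M: "\<And>a b. M $ a $ b = (\<Sum>v\<in>UNIV. d v * P $ v $ a * P $ v $ b)"
  shows "charpoly M = (\<Prod>v\<in>UNIV. [:- d v, 1:])"
proof -
  define C :: "real poly ^ 'n ^ 'n" where "C = (\<chi> v a. [:P $ v $ a:])"
  define D :: "real poly ^ 'n ^ 'n" where "D = (\<chi> u v. if u = v then [:- d v, 1:] else 0)"
  have "(transpose P ** P) $ a $ b = mat 1 $ a $ b" for a b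
    using P by (simp add: orthogonal_matrix)
  then have PP: "(\<Sum>v\<in>UNIV. P $ v $ a * P $ v $ b) = (if a = b then 1 else 0)" for a b
    by (simp add: matrix_matrix_mult_def transpose_def mat_def)
  have "transpose C ** C = mat 1"
    using sum_linear_poly[of "\<lambda>v. P $ v $ _ * P $ v $ _" "\<lambda>_. 0" UNIV]
    by (simp add: vec_eq_iff matrix_matrix_mult_def transpose_def mat_def C_def PP)
  then have C: "det (transpose C) * det C = 1" by (metis det_mul det_I)
  have "(\<chi> i j. (if i = j then [:0, 1:] else 0) - [:M $ i $ j:]) = transpose C ** D ** C"
  proof -
    have "(transpose C ** D ** C) $ a $ b = (if a = b then [:0, 1:] else 0) - [:M $ a $ b:]" for a b
    proof -
      have "(transpose C ** D ** C) $ a $ b =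
          (\<Sum>v\<in>UNIV. (\<Sum>u\<in>UNIV. [:P $ u $ a:] * (if u = v then [:- d v, 1:] else 0)) * [:P $ v $ b:])"
        by (simp add: matrix_matrix_mult_def transpose_def C_def D_def)
      also have "\<dots> = (\<Sum>v\<in>UNIV. [:- (d v * P $ v $ a * P $ v $ b), P $ v $ a * P $ v $ b:])"
        by (intro sum.cong refl) (simp add: if_distrib cong: if_cong)
      also have "\<dots> = [:- M $ a $ b, if a = b then 1 else 0:]"
        by (simp add: sum_linear_poly PP M sum_negf)
      finally show ?thesis by simp
    qed
    then show ?thesis by (simp add: vec_eq_iff)
  qed
  then have "charpoly M = det (transpose C) * det D * det C"
    by (simp add: charpoly_def det_mul)
  also have "\<dots> = det D" using C by (simp add: mult.commute mult.left_commute)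
  also have "\<dots> = (\<Prod>v\<in>UNIV. [:- d v, 1:])"
    by (subst det_diagonal) (auto simp: D_def)
  finally show ?thesis .
qed

text \<open>Links the sorted root list behind \<open>eigval\<close> to the index type of
  \<open>d\<close>, so that each eigenvalue keeps its own eigenvector even when values
  repeat.\<close>

lemma eigval_enumeration:
  fixes M :: "real ^ 'n ^ 'n"
  assumes "charpoly M = (\<Prod>v\<in>UNIV. [:- d v, 1:])"
  obtains \<sigma> :: "nat \<Rightarrow> 'n" where "bij_betw \<sigma> {1..CARD('n)} UNIV"
    "\<And>i. i \<in> {1..CARD('n)} \<Longrightarrow> eigval M i = d (\<sigma> i)"
    "\<And>i j. 1 \<le> i \<Longrightarrow> i \<le> j \<Longrightarrow> j \<le> CARD('n) \<Longrightarrow> eigval M j \<le> eigval M i"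
proof -
  obtain xs :: "'n list" where xs: "set xs = UNIV" "distinct xs"
    using finite_distinct_list[of "UNIV :: 'n set"] by auto
  \<comment> \<open>The indices are sorted rather than their values, since equal values of
    \<open>d\<close> must remain attached to distinct indices.\<close>
  define ys where "ys = rev (sort_key d xs)"
  have ys: "set ys = UNIV" "distinct ys" by (simp_all add: ys_def xs)
  have len: "length ys = CARD('n)" using distinct_card ys by metis
  have "proots (charpoly M) = (\<Sum>v\<in>UNIV. {#d v#})"
    by (simp add: assms proots_prod)
  also have "\<dots> = image_mset d (mset_set UNIV)"
    by (simp add: sum_unfold_sum_mset)
  also have "\<dots> = mset (map d xs)"
    using xs by (metis mset_map mset_set_set)
  finally have "sorted_list_of_multiset (proots (charpoly M)) = sort (map d xs)"
    by (simp only: sorted_list_of_multiset_mset)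
  also have "\<dots> = map d (sort_key d xs)"
    by (rule properties_for_sort) auto
  finally have ev: "eigval M i = map d ys ! (i - 1)" for i
    by (simp add: eigval_def ys_def rev_map)
  have sorted: "sorted_wrt (\<ge>) (map d ys)"
    by (simp add: ys_def rev_map[symmetric] sorted_wrt_rev)
  show ?thesis
  proof (rule that[of "\<lambda>i. ys ! (i - 1)"])
    have "bij_betw (\<lambda>i. i - 1) {1..CARD('n)} {..<CARD('n)}"
      by (rule bij_betwI[where g = Suc]) auto
    moreover have "bij_betw ((!) ys) {..<CARD('n)} UNIV"
      by (rule bij_betw_nth) (simp_all add: ys len)
    ultimately have "bij_betw ((!) ys \<circ> (\<lambda>i. i - 1)) {1..CARD('n)} UNIV"
      by (rule bij_betw_trans)
    then show "bij_betw (\<lambda>i. ys ! (i - 1)) {1..CARD('n)} UNIV"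
      by (simp add: comp_def)
    show "eigval M i = d (ys ! (i - 1))" if "i \<in> {1..CARD('n)}" for i
    proof -
      have "i - 1 < length ys" using that len by auto
      then show ?thesis by (simp add: ev)
    qed
    show "eigval M j \<le> eigval M i" if "1 \<le> i" "i \<le> j" "j \<le> CARD('n)" for i j
    proof (cases "i = j")
      case False
      then have "i - 1 < j - 1" "j - 1 < length (map d ys)" using that len by auto
      then show ?thesis using sorted unfolding ev by (metis sorted_wrt_iff_nth_less)
    qed simp
  qed
qed

text \<open>Lists the eigenvectors in the decreasing order of \<open>eigval\<close>. Completeness of
  the basis appears as an entrywise resolution of the identity, the form from which traces are
  computed.\<close>

lemma eigval_decomposition:
  fixes M :: "real ^ 'n ^ 'n"
  assumes "transpose M = M"
  obtains q :: "nat \<Rightarrow> real ^ 'n"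
  where "\<And>i. i \<in> {1..CARD('n)} \<Longrightarrow> q i \<bullet> q i = 1"
    "\<And>a b. (\<Sum>i = 1..CARD('n). q i $ a * q i $ b) = (if a = b then 1 else 0)"
    "\<And>a b. M $ a $ b = (\<Sum>i = 1..CARD('n). eigval M i * (q i $ a * q i $ b))"
    "\<And>i j. 1 \<le> i \<Longrightarrow> i \<le> j \<Longrightarrow> j \<le> CARD('n) \<Longrightarrow> eigval M j \<le> eigval M i"
proof -
  obtain P :: "real ^ 'n ^ 'n" and d where P: "orthogonal_matrix P"
    and M: "\<And>a b. M $ a $ b = (\<Sum>v\<in>UNIV. d v * P $ v $ a * P $ v $ b)"
    using symmetric_matrix_diagonalisation[OF assms] by blast
  obtain \<sigma> :: "nat \<Rightarrow> 'n" where \<sigma>: "bij_betw \<sigma> {1..CARD('n)} UNIV"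
    and ev: "\<And>i. i \<in> {1..CARD('n)} \<Longrightarrow> eigval M i = d (\<sigma> i)"
    and mono: "\<And>i j. 1 \<le> i \<Longrightarrow> i \<le> j \<Longrightarrow> j \<le> CARD('n) \<Longrightarrow> eigval M j \<le> eigval M i"
    using eigval_enumeration[OF charpoly_diagonalisation[OF P M]] by blast
  show ?thesis
  proof (rule that[of "\<lambda>i. row (\<sigma> i) P"])
    show "row (\<sigma> i) P \<bullet> row (\<sigma> i) P = 1" for i
      using P by (simp add: orthogonal_matrix_orthonormal_rows norm_eq_1[symmetric])
    have "(transpose P ** P) $ a $ b = mat 1 $ a $ b" for a b
      using P by (simp add: orthogonal_matrix)
    then have "(\<Sum>v\<in>UNIV. row v P $ a * row v P $ b) = (if a = b then 1 else 0)" for a b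
      by (simp add: matrix_matrix_mult_def transpose_def mat_def row_def)
    then show "(\<Sum>i = 1..CARD('n). row (\<sigma> i) P $ a * row (\<sigma> i) P $ b) = (if a = b then 1 else 0)" for a b
      using sum.reindex_bij_betw[OF \<sigma>, of "\<lambda>v. row v P $ a * row v P $ b"] by simp
    show "M $ a $ b = (\<Sum>i = 1..CARD('n). eigval M i * (row (\<sigma> i) P $ a * row (\<sigma> i) P $ b))" for a b
      using sum.reindex_bij_betw[OF \<sigma>, of "\<lambda>v. d v * (row v P $ a * row v P $ b)"]
      by (simp add: M ev row_def mult.assoc)
  qed (use mono in auto)
qed

subsection \<open>Ky Fan's inequality\<close>

text \<open>The double sum is the trace pairing of \<open>M\<close> and \<open>X\<close> (up to
  transposing one factor); by linearity each rank-one term of \<open>M\<close> contributes a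
  quadratic form of \<open>X\<close>.\<close>

lemma frobenius_rank_one_sum:
  fixes X M :: "real ^ 'n ^ 'n" and q :: "'i \<Rightarrow> real ^ 'n"
  assumes "\<And>a b. M $ a $ b = (\<Sum>i\<in>I. c i * (q i $ a * q i $ b))"
  shows "(\<Sum>a\<in>UNIV. \<Sum>b\<in>UNIV. M $ a $ b * X $ a $ b) = (\<Sum>i\<in>I. c i * (q i \<bullet> (X *v q i)))"
proof -
  have "(\<Sum>a\<in>UNIV. \<Sum>b\<in>UNIV. M $ a $ b * X $ a $ b) =
      (\<Sum>a\<in>UNIV. \<Sum>b\<in>UNIV. \<Sum>i\<in>I. c i * (q i $ a * q i $ b) * X $ a $ b)"
    by (simp add: assms sum_distrib_right)
  also have "\<dots> = (\<Sum>a\<in>UNIV. \<Sum>i\<in>I. \<Sum>b\<in>UNIV. c i * (q i $ a * q i $ b) * X $ a $ b)"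
    by (intro sum.cong refl sum.swap)
  also have "\<dots> = (\<Sum>i\<in>I. \<Sum>a\<in>UNIV. \<Sum>b\<in>UNIV. c i * (q i $ a * q i $ b) * X $ a $ b)"
    by (rule sum.swap)
  also have "\<dots> = (\<Sum>i\<in>I. c i * (q i \<bullet> (X *v q i)))"
    by (simp add: inner_vec_def matrix_vector_mult_def sum_distrib_left mult.assoc mult.left_commute mult.commute)
  finally show ?thesis .
qed

text \<open>With \<open>b\<close> the indicator of \<open>T\<close>, every product
  \<open>(\<mu> i - c) * (a i - b i)\<close> is at most 0, and \<open>c\<close> cancels in the sum
  because \<open>a\<close> and \<open>b\<close> have the same total.\<close>

lemma sum_le_sum_of_largest:
  fixes \<mu> a :: "'i \<Rightarrow> real"
  assumes fin: "finite I" and T: "T \<subseteq> I"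
    and ge: "\<And>i. i \<in> T \<Longrightarrow> c \<le> \<mu> i" and le: "\<And>i. i \<in> I - T \<Longrightarrow> \<mu> i \<le> c"
    and a: "\<And>i. i \<in> I \<Longrightarrow> 0 \<le> a i \<and> a i \<le> 1" and sum: "(\<Sum>i\<in>I. a i) = card T"
  shows "(\<Sum>i\<in>I. \<mu> i * a i) \<le> (\<Sum>i\<in>T. \<mu> i)"
proof -
  define b :: "'i \<Rightarrow> real" where "b i = (if i \<in> T then 1 else 0)" for i
  have "(\<Sum>i\<in>I. (\<mu> i - c) * (a i - b i)) \<le> 0"
    using ge le a by (intro sum_nonpos) (auto simp: b_def mult_nonneg_nonpos mult_nonpos_nonneg)
  moreover have "(\<Sum>i\<in>I. b i) = card T" "(\<Sum>i\<in>I. \<mu> i * b i) = (\<Sum>i\<in>T. \<mu> i)"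
    using fin T by (simp_all add: b_def if_distrib[of "(*) _"] sum.If_cases Int_absorb1 cong: if_cong)
  ultimately show ?thesis
    using sum by (simp add: algebra_simps sum.distrib sum_subtractf flip: sum_distrib_left)
qed

subsection \<open>Fractional colourings\<close>

definition fractional_coloring :: "('v::finite \<times> 'v) set \<Rightarrow> ('v set \<Rightarrow> real) \<Rightarrow> bool" where
  "fractional_coloring E y \<longleftrightarrow> (\<forall>S. coclique E S \<longrightarrow> 0 \<le> y S) \<and>
     (\<forall>v. (\<Sum>S | coclique E S \<and> v \<in> S. y S) = 1)"

text \<open>Double counting: the cocliques through a vertex have total weight 1.\<close>

lemma sum_over_cocliques_swap:
  assumes "fractional_coloring E y"
  shows "(\<Sum>S | coclique E S. y S * (\<Sum>i\<in>S. g i)) = (\<Sum>i\<in>UNIV. g i :: real)"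
proof -
  have "(\<Sum>S | coclique E S. y S * (\<Sum>i\<in>S. g i)) =
      (\<Sum>S | coclique E S. \<Sum>i\<in>UNIV. if i \<in> S then y S * g i else 0)"
    by (simp add: sum_distrib_left sum.If_cases)
  also have "\<dots> = (\<Sum>i\<in>UNIV. \<Sum>S | coclique E S. if i \<in> S then y S * g i else 0)"
    by (rule sum.swap)
  also have "\<dots> = (\<Sum>i\<in>UNIV. (\<Sum>S | coclique E S \<and> i \<in> S. y S) * g i)"
    by (simp add: sum.If_cases sum_distrib_right Collect_conj_eq)
  finally show ?thesis using assms by (simp add: fractional_coloring_def)
qed

lemma fractional_coloring_weight_ge_1:
  assumes "fractional_coloring E y"
  shows "1 \<le> (\<Sum>S | coclique E S. y S)"
proof -
  \<comment> \<open>Here \<open>undefined\<close> serves as an arbitrary vertex; types are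
    nonempty.\<close>
  have "1 = (\<Sum>S | coclique E S \<and> undefined \<in> S. y S)"
    using assms by (simp add: fractional_coloring_def)
  also have "\<dots> \<le> (\<Sum>S | coclique E S. y S)"
    using assms by (intro sum_mono2) (auto simp: fractional_coloring_def)
  finally show ?thesis .
qed

text \<open>Shows that fractional colourings exist and that the optimum is at most the number of
  vertices.\<close>

lemma fractional_coloring_singletons:
  fixes E :: "('v::finite \<times> 'v) set"
  assumes "irrefl E"
  defines "y \<equiv> \<lambda>S. if card S = 1 then 1 else (0::real)"
  shows "fractional_coloring E y" "(\<Sum>S | coclique E S. y S) = CARD('v)"
proof -
  have co: "coclique E S" if "card S = 1" for S
    using that assms(1) by (auto simp: coclique_def irrefl_def card_1_singleton_iff)
  have "(\<Sum>S | coclique E S \<and> v \<in> S. y S) = 1" for v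
  proof -
    have "{S. (coclique E S \<and> v \<in> S) \<and> card S = 1} = {{v}}"
      using co by (auto simp: card_1_singleton_iff)
    then show ?thesis by (simp add: y_def sum.If_cases flip: Collect_conj_eq)
  qed
  then show "fractional_coloring E y" by (simp add: fractional_coloring_def y_def)
  have "{S. coclique E S \<and> card S = 1} = range (\<lambda>v. {v})"
    using co by (auto simp: card_1_singleton_iff)
  moreover have "card (range (\<lambda>v::'v. {v})) = CARD('v)" by (intro card_image) (auto simp: inj_on_def)
  ultimately show "(\<Sum>S | coclique E S. y S) = CARD('v)"
    by (simp add: y_def sum.If_cases flip: Collect_conj_eq)
qed

text \<open>A continuous objective attains its minimum on the compact set \<open>K\<close>, and
  every colouring can be moved into \<open>K\<close> without raising its weight. Attainment matters
  when the optimum is an integer: near-optimal colourings could then exceed the ceiling.\<close>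

lemma fractional_chromatic_number_attained:
  fixes E :: "('v::finite \<times> 'v) set"
  assumes "irrefl E"
  obtains y where "fractional_coloring E y"
    "fractional_chromatic_number E = (\<Sum>S | coclique E S. y S)"
    "fractional_chromatic_number E \<le> CARD('v)"
proof -
  let ?c = "\<lambda>y. \<Sum>S | coclique E S. y S :: real"
  \<comment> \<open>The weight of the empty coclique is not bounded by the covering constraints.\<close>
  define K where "K = {y :: real ^ 'v set. (\<forall>S. 0 \<le> y $ S) \<and> (\<forall>S. y $ S \<le> 1) \<and>
    (\<forall>v. (\<Sum>S | coclique E S \<and> v \<in> S. y $ S) = 1)}"
  have reduce: "\<exists>z\<in>K. ?c (($) z) \<le> ?c y" if y: "fractional_coloring E y" for y
  proof -
    define z where "z = (\<chi> S. if coclique E S \<and> S \<noteq> {} then y S else 0)"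
    have "y S \<le> 1" if "coclique E S" "v \<in> S" for S v
    proof -
      have "y S \<le> (\<Sum>S | coclique E S \<and> v \<in> S. y S)"
        using y that by (intro member_le_sum) (auto simp: fractional_coloring_def)
      then show ?thesis using y by (simp add: fractional_coloring_def)
    qed
    moreover have "(\<Sum>S | coclique E S \<and> v \<in> S. z $ S) = (\<Sum>S | coclique E S \<and> v \<in> S. y S)" for v
      by (intro sum.cong) (auto simp: z_def)
    ultimately have "z \<in> K" using y by (auto simp: K_def z_def fractional_coloring_def)
    moreover have "?c (($) z) \<le> ?c y"
      using y by (intro sum_mono) (auto simp: z_def fractional_coloring_def)
    ultimately show ?thesis by blast
  qed
  have "compact K"
  proof -
    have "closed K" unfolding K_def
      by (intro closed_Collect_conj closed_Collect_all closed_Collect_le closed_Collect_eq continuous_intros)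
    moreover have "K \<subseteq> cbox 0 1" by (auto simp: K_def mem_box_cart)
    ultimately show ?thesis by (meson bounded_cbox bounded_subset compact_eq_bounded_closed)
  qed
  moreover have "K \<noteq> {}" using reduce[OF fractional_coloring_singletons(1)[OF assms]] by blast
  moreover have "continuous_on K (\<lambda>y. ?c (($) y))" by (intro continuous_intros)
  ultimately obtain x where x: "x \<in> K" and min: "\<And>z. z \<in> K \<Longrightarrow> ?c (($) x) \<le> ?c (($) z)"
    using continuous_attains_inf[of K "\<lambda>y. ?c (($) y)"] by blast
  have fx: "fractional_coloring E (($) x)" using x by (simp add: K_def fractional_coloring_def)
  have least: "?c (($) x) \<le> ?c y" if "fractional_coloring E y" for y
    using reduce[OF that] min by fastforce
  have "fractional_chromatic_number E = Inf {?c y | y. fractional_coloring E y}"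
    by (simp add: fractional_chromatic_number_def fractional_coloring_def)
  also have "\<dots> = ?c (($) x)"
    using fx least by (intro cInf_eq_minimum) auto
  finally show ?thesis
    using that[OF fx] least[OF fractional_coloring_singletons(1)[OF assms]]
      fractional_coloring_singletons(2)[OF assms] by simp
qed


subsection \<open>The dual matrix of a fractional colouring\<close>

text \<open>The form at \<open>z\<close> is the pairing with the outer product of \<open>z\<close>
  with itself, so \<open>frobenius_rank_one_sum\<close> applies.\<close>

lemma quadratic_form_rank_one_sum:
  fixes u :: "'i \<Rightarrow> real ^ 'n"
  shows "z \<bullet> ((\<chi> a b. \<Sum>S\<in>F. c S * (u S $ a * u S $ b)) *v z) = (\<Sum>S\<in>F. c S * (u S \<bullet> z)\<^sup>2)"
proof -
  have square: "u S \<bullet> ((\<chi> a b. z $ a * z $ b) *v u S) = (u S \<bullet> z)\<^sup>2" for S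
    by (simp add: inner_vec_def matrix_vector_mult_def power2_eq_square sum_product
        sum_distrib_left mult.assoc mult.left_commute mult.commute)
  have "z \<bullet> ((\<chi> a b. \<Sum>S\<in>F. c S * (u S $ a * u S $ b)) *v z) =
     (\<Sum>a\<in>UNIV. \<Sum>b\<in>UNIV. (\<Sum>S\<in>F. c S * (u S $ a * u S $ b)) * (\<chi> a b. z $ a * z $ b) $ a $ b)"
    by (simp add: inner_vec_def matrix_vector_mult_def sum_distrib_left mult.assoc mult.left_commute mult.commute)
  also have "\<dots> = (\<Sum>S\<in>F. c S * (u S \<bullet> ((\<chi> a b. z $ a * z $ b) *v u S)))"
    using frobenius_rank_one_sum[of "\<chi> a b. \<Sum>S\<in>F. c S * (u S $ a * u S $ b)" c u F "\<chi> a b. z $ a * z $ b"] by simp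
  finally show ?thesis by (simp add: square)
qed

text \<open>Each \<open>u S\<close> is supported on the coclique \<open>S\<close>, hence the zeros
  on edges. Cauchy-Schwarz bounds \<open>(u S \<bullet> z)\<^sup>2\<close> by the squared length of
  \<open>z\<close> restricted to \<open>S\<close>, with equality at \<open>x\<close>; weighted by
  \<open>y\<close>, these squared lengths add up to \<open>z \<bullet> z\<close>.\<close>

lemma coloring_matrix_trace_le:
  fixes E :: "('v::finite \<times> 'v) set" and x :: "real ^ 'v"
  assumes y: "fractional_coloring E y"
  obtains Y :: "real ^ 'v ^ 'v"
  where "\<And>i j. (i, j) \<in> E \<Longrightarrow> Y $ i $ j = 0"
    "\<And>z. 0 \<le> z \<bullet> (Y *v z)" "\<And>z. z \<bullet> (Y *v z) \<le> z \<bullet> z"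
    "x \<bullet> (Y *v x) = x \<bullet> x" "trace Y \<le> (\<Sum>S | coclique E S. y S)"
proof -
  \<comment> \<open>The map \<open>r S\<close> is the orthogonal projection onto the coordinates in
    \<open>S\<close>.\<close>
  define r where "r S z = (\<chi> i. if i \<in> S then z $ i else 0)" for S and z :: "real ^ 'v"
  \<comment> \<open>If \<open>x\<close> vanishes on \<open>S\<close>, division by 0 makes \<open>u S = 0\<close>.\<close>
  define u where "u S = (1 / norm (r S x)) *\<^sub>R r S x" for S
  define Y where "Y = (\<chi> a b. \<Sum>S | coclique E S. y S * (u S $ a * u S $ b))"
  have nonneg: "0 \<le> y S" if "S \<in> Collect (coclique E)" for S
    using y that by (simp add: fractional_coloring_def)
  have inner_r: "r S p \<bullet> q = r S p \<bullet> r S q" for S p q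
    by (auto simp: r_def inner_vec_def intro!: sum.cong)
  have norm_r: "r S z \<bullet> r S z = (\<Sum>i\<in>S. (z $ i)\<^sup>2)" for S z
    by (simp add: r_def inner_vec_def power2_eq_square sum.If_cases if_distrib cong: if_cong)
  have uu: "u S \<bullet> u S \<le> 1" for S
    by (cases "r S x = 0") (simp_all add: u_def dot_square_norm power2_eq_square)
  have ux: "(u S \<bullet> x)\<^sup>2 = r S x \<bullet> r S x" for S
    by (cases "r S x = 0")
      (simp_all add: u_def inner_r[of S x x] dot_square_norm power2_eq_square)
  have uz: "(u S \<bullet> z)\<^sup>2 \<le> r S z \<bullet> r S z" for S z
  proof -
    have "u S \<bullet> z = u S \<bullet> r S z" by (simp add: u_def inner_r[of S x z])
    then have "(u S \<bullet> z)\<^sup>2 \<le> (u S \<bullet> u S) * (r S z \<bullet> r S z)" using Cauchy_Schwarz_ineq by metis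
    also have "\<dots> \<le> r S z \<bullet> r S z" using uu[of S] by (intro mult_left_le_one_le) auto
    finally show ?thesis .
  qed
  have total: "(\<Sum>S | coclique E S. y S * (r S z \<bullet> r S z)) = z \<bullet> z" for z
    using sum_over_cocliques_swap[OF y, of "\<lambda>i. (z $ i)\<^sup>2"]
    by (simp add: norm_r) (simp add: inner_vec_def power2_eq_square)
  have form: "z \<bullet> (Y *v z) = (\<Sum>S | coclique E S. y S * (u S \<bullet> z)\<^sup>2)" for z
    unfolding Y_def by (rule quadratic_form_rank_one_sum)
  show ?thesis
  proof
    show "Y $ i $ j = 0" if "(i, j) \<in> E" for i j
      using that by (auto simp: Y_def u_def r_def coclique_def intro!: sum.neutral)
    show "0 \<le> z \<bullet> (Y *v z)" for z
      unfolding form using nonneg by (intro sum_nonneg mult_nonneg_nonneg) auto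
    show "z \<bullet> (Y *v z) \<le> z \<bullet> z" for z
      unfolding form total[of z, symmetric] using nonneg uz by (intro sum_mono mult_left_mono) auto
    show "x \<bullet> (Y *v x) = x \<bullet> x"
      unfolding form total[of x, symmetric] by (simp add: ux)
    have "trace Y = (\<Sum>S | coclique E S. y S * (u S \<bullet> u S))"
      unfolding trace_def Y_def
      by (simp add: inner_vec_def sum_distrib_left) (rule sum.swap)
    also have "\<dots> \<le> (\<Sum>S | coclique E S. y S)"
      using nonneg uu by (intro sum_mono mult_left_le) auto
    finally show "trace Y \<le> (\<Sum>S | coclique E S. y S)" .
  qed
qed

text \<open>Moving from \<open>Y\<close> towards the identity raises the trace continuously up to
  \<open>CARD('v)\<close>. Both endpoints vanish on edges, have forms between 0 and
  \<open>z \<bullet> z\<close>, and attain the upper bound at \<open>x\<close>, so every point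
  between them does too.\<close>

lemma coloring_matrix:
  fixes E :: "('v::finite \<times> 'v) set" and x :: "real ^ 'v"
  assumes y: "fractional_coloring E y" and E: "irrefl E"
    and k: "(\<Sum>S | coclique E S. y S) \<le> k" "k \<le> CARD('v)"
  obtains X :: "real ^ 'v ^ 'v"
  where "\<And>i j. (i, j) \<in> E \<Longrightarrow> X $ i $ j = 0"
    "\<And>z. 0 \<le> z \<bullet> (X *v z)" "\<And>z. z \<bullet> (X *v z) \<le> z \<bullet> z"
    "x \<bullet> (X *v x) = x \<bullet> x" "trace X = k"
proof -
  obtain Y :: "real ^ 'v ^ 'v" where Y: "\<And>i j. (i, j) \<in> E \<Longrightarrow> Y $ i $ j = 0"
    "\<And>z. 0 \<le> z \<bullet> (Y *v z)" "\<And>z. z \<bullet> (Y *v z) \<le> z \<bullet> z"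
    "x \<bullet> (Y *v x) = x \<bullet> x" "trace Y \<le> (\<Sum>S | coclique E S. y S)"
    using coloring_matrix_trace_le[OF y, of x] by metis
  \<comment> \<open>If \<open>trace Y\<close> is already \<open>CARD('v)\<close>, then so is \<open>k\<close>, and \<open>t = 0\<close>.\<close>
  define t where "t = (k - trace Y) / (CARD('v) - trace Y)"
  have t: "0 \<le> t" "t \<le> 1" and tk: "trace Y + t * (CARD('v) - trace Y) = k"
    using Y(5) k by (auto simp: t_def divide_le_eq_1)
  define X where "X = Y + t *\<^sub>R (mat 1 - Y)"
  have form: "z \<bullet> (X *v z) = z \<bullet> (Y *v z) + t * (z \<bullet> z - z \<bullet> (Y *v z))" for z
    by (simp add: X_def matrix_vector_mult_add_rdistrib matrix_vector_mult_diff_rdistrib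
        inner_add_right inner_diff_right flip: scaleR_matrix_vector_assoc)
  show ?thesis
  proof
    show "X $ i $ j = 0" if "(i, j) \<in> E" for i j
      using that Y(1) E by (auto simp: X_def mat_def irrefl_def)
    show "0 \<le> z \<bullet> (X *v z)" for z
      unfolding form using Y(2,3)[of z] t by (intro add_nonneg_nonneg mult_nonneg_nonneg) auto
    show "z \<bullet> (X *v z) \<le> z \<bullet> z" for z
      unfolding form using Y(3)[of z] t mult_left_le_one_le[of "z \<bullet> z - z \<bullet> (Y *v z)" t] by auto
    show "x \<bullet> (X *v x) = x \<bullet> x" by (simp add: form Y(4))
    have "trace X = trace Y + t * (CARD('v) - trace Y)"
      by (simp add: X_def trace_def mat_def sum.distrib sum_subtractf flip: sum_distrib_left)
    then show "trace X = k" using tk by simp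
  qed
qed

section \<open>Pairing with an eigenbasis\<close>

lemma quadratic_form_sum_eq_trace:
  fixes X :: "real ^ 'n ^ 'n" and q :: "'i \<Rightarrow> real ^ 'n"
  assumes "\<And>a b. (\<Sum>i\<in>I. q i $ a * q i $ b) = (if a = b then 1 else 0)"
  shows "(\<Sum>i\<in>I. q i \<bullet> (X *v q i)) = trace X"
  using frobenius_rank_one_sum[of "mat 1" "\<lambda>_. 1" q I X] assms
  by (simp add: mat_def trace_def if_distrib[of "\<lambda>x. x * _"] cong: if_cong)

text \<open>In an eigenbasis of \<open>M\<close> the pairing is a combination of eigenvalues with
  coefficients in [0,1] of total \<open>k\<close>, so it is largest when the top \<open>k\<close>
  eigenvalues get coefficient 1.\<close>

lemma sum_entries_le_sum_eigval:
  fixes M X :: "real ^ 'n ^ 'n"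
  assumes M: "transpose M = M" and k: "1 \<le> k" "k \<le> CARD('n)"
    and X: "\<And>z. 0 \<le> z \<bullet> (X *v z)" "\<And>z. z \<bullet> (X *v z) \<le> z \<bullet> z" "trace X = k"
  shows "(\<Sum>a\<in>UNIV. \<Sum>b\<in>UNIV. M $ a $ b * X $ a $ b) \<le> (\<Sum>i = 1..k. eigval M i)"
proof -
  obtain q :: "nat \<Rightarrow> real ^ 'n" where q: "\<And>i. i \<in> {1..CARD('n)} \<Longrightarrow> q i \<bullet> q i = 1"
    "\<And>a b. (\<Sum>i = 1..CARD('n). q i $ a * q i $ b) = (if a = b then 1 else 0)"
    "\<And>a b. M $ a $ b = (\<Sum>i = 1..CARD('n). eigval M i * (q i $ a * q i $ b))"
    and mono: "\<And>i j. 1 \<le> i \<Longrightarrow> i \<le> j \<Longrightarrow> j \<le> CARD('n) \<Longrightarrow> eigval M j \<le> eigval M i"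
    using eigval_decomposition[OF M] by blast
  have "(\<Sum>a\<in>UNIV. \<Sum>b\<in>UNIV. M $ a $ b * X $ a $ b) =
      (\<Sum>i = 1..CARD('n). eigval M i * (q i \<bullet> (X *v q i)))"
    by (rule frobenius_rank_one_sum) (rule q(3))
  also have "\<dots> \<le> (\<Sum>i = 1..k. eigval M i)"
  proof (rule sum_le_sum_of_largest[where c = "eigval M k"])
    show "(\<Sum>i = 1..CARD('n). q i \<bullet> (X *v q i)) = card {1..k}"
      using quadratic_form_sum_eq_trace[OF q(2)] X(3) by simp
    show "0 \<le> q i \<bullet> (X *v q i) \<and> q i \<bullet> (X *v q i) \<le> 1" if "i \<in> {1..CARD('n)}" for i
      using X(1) X(2)[of "q i"] q(1)[OF that] by simp
  qed (use k mono in auto)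
  finally show ?thesis .
qed

subsection \<open>The bounds\<close>

text \<open>Weak duality: the matrix \<open>X\<close> built from the square root of \<open>w\<close>
  has pairing \<open>w \<bullet> 1\<close> with every \<open>sqrt_outer w + Z\<close>, which bounds
  the whole set under the infimum.\<close>

lemma vartheta_ge_of_fractional_coloring:
  fixes E :: "('v::finite \<times> 'v) set" and w :: "real ^ 'v"
  assumes y: "fractional_coloring E y" and E: "irrefl E"
    and k: "(\<Sum>S | coclique E S. y S) \<le> k" "k \<le> CARD('v)" and w: "\<forall>i. 0 \<le> w $ i"
  shows "w \<bullet> 1 \<le> vartheta k E w"
  unfolding vartheta_def
proof (rule cInf_greatest)
  have "0 \<in> weighted_adjacency E" by (simp add: weighted_adjacency_def transpose_def vec_eq_iff)
  then show "{\<Sum>i = 1..k. eigval (sqrt_outer w + Z) i |Z. Z \<in> weighted_adjacency E} \<noteq> {}"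
    by blast
next
  fix s assume "s \<in> {\<Sum>i = 1..k. eigval (sqrt_outer w + Z) i |Z. Z \<in> weighted_adjacency E}"
  then obtain Z where Z: "Z \<in> weighted_adjacency E"
    and s: "s = (\<Sum>i = 1..k. eigval (sqrt_outer w + Z) i)" by blast
  define x :: "real ^ 'v" where "x = (\<chi> i. sqrt (w $ i))"
  obtain X :: "real ^ 'v ^ 'v" where X: "\<And>i j. (i, j) \<in> E \<Longrightarrow> X $ i $ j = 0"
    "\<And>z. 0 \<le> z \<bullet> (X *v z)" "\<And>z. z \<bullet> (X *v z) \<le> z \<bullet> z"
    "x \<bullet> (X *v x) = x \<bullet> x" "trace X = k"
    using coloring_matrix[OF y E k(1), of x] k(2) by auto
  \<comment> \<open>\<open>Z\<close> vanishes off the edges and \<open>X\<close> on them, so their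
    supports are disjoint.\<close>
  have ZX: "Z $ a $ b * X $ a $ b = 0" for a b
    using Z X(1) by (cases "(a, b) \<in> E") (auto simp: weighted_adjacency_def)
  have "w \<bullet> 1 = x \<bullet> x" using w by (simp add: inner_vec_def x_def)
  also have "\<dots> = (\<Sum>a\<in>UNIV. \<Sum>b\<in>UNIV. sqrt_outer w $ a $ b * X $ a $ b)"
    by (simp flip: X(4))
      (simp add: inner_vec_def matrix_vector_mult_def sqrt_outer_def x_def sum_distrib_left ac_simps)
  also have "\<dots> = (\<Sum>a\<in>UNIV. \<Sum>b\<in>UNIV. (sqrt_outer w + Z) $ a $ b * X $ a $ b)"
    by (simp add: distrib_right ZX)
  also have "\<dots> \<le> (\<Sum>i = 1..k. eigval (sqrt_outer w + Z) i)"
  proof (rule sum_entries_le_sum_eigval[OF _ _ k(2) X(2,3,5)])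
    show "transpose (sqrt_outer w + Z) = sqrt_outer w + Z"
      using Z by (auto simp: weighted_adjacency_def sqrt_outer_def transpose_def vec_eq_iff mult.commute)
    show "1 \<le> k" using fractional_coloring_weight_ge_1[OF y] k(1) by simp
  qed
  finally show "w \<bullet> 1 \<le> s" by (simp add: s)
qed

text \<open>Choosing \<open>X\<close> for the top eigenvector \<open>q 1\<close> fixes the
  coefficient of the largest eigenvalue at 1; a zero pairing with \<open>Z\<close> then forces the
  other eigenvalues to compensate.\<close>

lemma h_graph_le_of_fractional_coloring:
  fixes E :: "('v::finite \<times> 'v) set"
  assumes y: "fractional_coloring E y" and E: "irrefl E"
    and k: "(\<Sum>S | coclique E S. y S) \<le> k" "k \<le> CARD('v)"
  shows "h_graph E \<le> k"
  unfolding h_graph_def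
proof (rule Least_le, intro conjI ballI)
  show k1: "1 \<le> k" using fractional_coloring_weight_ge_1[OF y] k(1) by simp
  let ?n = "CARD('v)"
  have n: "1 \<le> ?n" using k1 k(2) by simp
  fix Z assume Z: "Z \<in> weighted_adjacency E"
  then have "transpose Z = Z" by (simp add: weighted_adjacency_def)
  then obtain q :: "nat \<Rightarrow> real ^ 'v" where q: "\<And>i. i \<in> {1..?n} \<Longrightarrow> q i \<bullet> q i = 1"
    "\<And>a b. (\<Sum>i = 1..?n. q i $ a * q i $ b) = (if a = b then 1 else 0)"
    "\<And>a b. Z $ a $ b = (\<Sum>i = 1..?n. eigval Z i * (q i $ a * q i $ b))"
    and mono: "\<And>i j. 1 \<le> i \<Longrightarrow> i \<le> j \<Longrightarrow> j \<le> ?n \<Longrightarrow> eigval Z j \<le> eigval Z i"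
    using eigval_decomposition by blast
  obtain X :: "real ^ 'v ^ 'v" where X: "\<And>i j. (i, j) \<in> E \<Longrightarrow> X $ i $ j = 0"
    "\<And>z. 0 \<le> z \<bullet> (X *v z)" "\<And>z. z \<bullet> (X *v z) \<le> z \<bullet> z"
    "q 1 \<bullet> (X *v q 1) = q 1 \<bullet> q 1" "trace X = k"
    using coloring_matrix[OF y E k(1), of "q 1"] k(2) by auto
  define a where "a i = q i \<bullet> (X *v q i)" for i
  have a1: "a 1 = 1" using X(4) q(1)[of 1] n by (simp add: a_def)
  have split: "(\<Sum>i = 1..?n. g i) = g 1 + (\<Sum>i = 2..?n. g i)" for g :: "nat \<Rightarrow> real"
    using n by (simp add: sum.atLeast_Suc_atMost numeral_2_eq_2)
  have ZX: "Z $ a $ b * X $ a $ b = 0" for a b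
    using Z X(1) by (cases "(a, b) \<in> E") (auto simp: weighted_adjacency_def)
  have "0 = (\<Sum>i = 1..?n. eigval Z i * a i)"
    using frobenius_rank_one_sum[where c = "eigval Z", OF q(3), of X] by (simp add: ZX a_def)
  then have zero: "eigval Z 1 + (\<Sum>i = 2..?n. eigval Z i * a i) = 0"
    by (simp add: split a1 del: One_nat_def)
  \<comment> \<open>Negation turns the \<open>k - 1\<close> smallest eigenvalues, at indices
    \<open>?n + 2 - k\<close> to \<open>?n\<close>, into the largest ones. The threshold index
    \<open>?n + 1 - k\<close> lies just before this block and stays valid when the block is empty
    (\<open>k = 1\<close>) or is all of \<open>{2..?n}\<close> (\<open>k = ?n\<close>).\<close>
  have "(\<Sum>i = 2..?n. - eigval Z i * a i) \<le> (\<Sum>i = ?n + 2 - k..?n. - eigval Z i)"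
  proof (rule sum_le_sum_of_largest[where c = "- eigval Z (?n + 1 - k)"])
    have "(\<Sum>i = 1..?n. a i) = k"
      using quadratic_form_sum_eq_trace[OF q(2)] X(5) by (simp add: a_def)
    then show "(\<Sum>i = 2..?n. a i) = card {?n + 2 - k..?n}"
      using k1 k(2) by (simp add: split a1 del: One_nat_def)
    show "0 \<le> a i \<and> a i \<le> 1" if "i \<in> {2..?n}" for i
      using X(2) X(3)[of "q i"] q(1)[of i] that by (simp add: a_def)
  qed (use k1 k(2) mono in auto)
  moreover have "(\<Sum>i = 1..k - 1. eigval Z (?n + 1 - i)) = (\<Sum>i = ?n + 2 - k..?n. eigval Z i)"
    using k1 k(2)
    by (intro sum.reindex_bij_witness[of _ "\<lambda>i. ?n + 1 - i" "\<lambda>i. ?n + 1 - i"]) auto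
  ultimately show "eigval Z 1 + (\<Sum>i = 1..k - 1. eigval Z (?n + 1 - i)) \<le> 0"
    using zero by (simp add: sum_negf)
qed

theorem theorem5:
  fixes E :: "('v::finite \<times> 'v) set"
  assumes "simple_graph E"
  shows "int (Min {k \<in> {1..CARD('v)}.
            \<forall>w :: real ^ 'v. (\<forall>i. 0 \<le> w $ i) \<longrightarrow> w \<bullet> 1 \<le> vartheta k E w})
           \<le> \<lceil>fractional_chromatic_number E\<rceil>
       \<and> int (h_graph E) \<le> \<lceil>fractional_chromatic_number E\<rceil>"
proof -
  have E: "irrefl E" using assms by (simp add: simple_graph_def)
  obtain y where y: "fractional_coloring E y"
    and chi: "fractional_chromatic_number E = (\<Sum>S | coclique E S. y S)"
    and le: "fractional_chromatic_number E \<le> CARD('v)"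
    using fractional_chromatic_number_attained[OF E] .
  define k where "k = nat \<lceil>fractional_chromatic_number E\<rceil>"
  have ge1: "1 \<le> fractional_chromatic_number E"
    using fractional_coloring_weight_ge_1[OF y] by (simp add: chi)
  \<comment> \<open>The ceiling is positive, so \<open>nat\<close> does not truncate it.\<close>
  then have kint: "int k = \<lceil>fractional_chromatic_number E\<rceil>" by (simp add: k_def)
  have k: "(\<Sum>S | coclique E S. y S) \<le> k" "1 \<le> k" "k \<le> CARD('v)"
    using ge1 le kint unfolding chi by linarith+
  have "Min {k \<in> {1..CARD('v)}.
      \<forall>w :: real ^ 'v. (\<forall>i. 0 \<le> w $ i) \<longrightarrow> w \<bullet> 1 \<le> vartheta k E w} \<le> k"
    using k vartheta_ge_of_fractional_coloring[OF y E k(1,3)] by (intro Min_le) auto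
  moreover have "h_graph E \<le> k" by (rule h_graph_le_of_fractional_coloring[OF y E k(1,3)])
  ultimately show ?thesis by (simp flip: kint)
qed

end
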